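(* There does not exist a $(v,3,k,\lambda)$-SEDF for any $v>3$.
   Context: Let $v,m,k,\lambda$ be positive integers with $k^2(m-1)=\lambda(v-1)$. A $(v,m,k,\lambda)$-SEDF (strong external difference family) is a collection $(D_1,\ldots,D_m)$ of pairwise disjoint subsets of some finite abelian group $G$ (written multiplicatively, with identity $1$) with $|G|=v$ and $|D_j|=k$ for all $1\le j\le m$, such that for each $1\le j\le m$ the equation $\sum_{\ell\ne j} D_j D_\ell^{-1}=\lambda(G-1)$ holds in the group algebra $\mathbb{C}[G]$. Here a subset $S\subseteq G$ is identified with the group algebra element $\sum_{g\in S} g$, and $S^{-1}$ denotes $\sum_{g\in S} g^{-1}$. *)

theory Defs
  imports Complex_Main "HOL-Algebra.Algebra" "HOL-Library.Disjoint_Sets"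
begin

text \<open>
  The complex group algebra of a finite group: an element \<open>\<Sum>g\<in>G. f\<^sub>g g\<close> is represented by its
  coefficient function, required to vanish outside the carrier so that equality in the algebra is
  equality of functions. The product is convolution.
\<close>

definition group_algebra :: "('a, 'b) monoid_scheme \<Rightarrow> (complex, 'a \<Rightarrow> complex) module" where
  "group_algebra G =
    \<lparr>carrier = {f. \<forall>x. x \<notin> carrier G \<longrightarrow> f x = 0},
     monoid.mult = (\<lambda>f g x. if x \<in> carrier G
                     then \<Sum>y\<in>carrier G. f y * g (inv\<^bsub>G\<^esub> y \<otimes>\<^bsub>G\<^esub> x) else 0),
     monoid.one = (\<lambda>x. if x = \<one>\<^bsub>G\<^esub> then 1 else 0),
     ring.zero = (\<lambda>x. 0),
     ring.add = (\<lambda>f g x. f x + g x),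
     module.smult = (\<lambda>c f x. c * f x)\<rparr>"

definition set_elem :: "'a set \<Rightarrow> 'a \<Rightarrow> complex" where
  "set_elem S = (\<lambda>x. if x \<in> S then 1 else 0)"

definition is_SEDF ::
  "('a, 'b) monoid_scheme \<Rightarrow> nat \<Rightarrow> nat \<Rightarrow> nat \<Rightarrow> nat \<Rightarrow> (nat \<Rightarrow> 'a set) \<Rightarrow> bool" where
  "is_SEDF G v m k lam D \<longleftrightarrow>
     0 < v \<and> 0 < m \<and> 0 < k \<and> 0 < lam \<and> k\<^sup>2 * (m - 1) = lam * (v - 1) \<and>
     comm_group G \<and> finite (carrier G) \<and> order G = v \<and>
     (\<forall>j\<in>{1..m}. D j \<subseteq> carrier G \<and> card (D j) = k) \<and>
     disjoint_family_on D {1..m} \<and>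
     (\<forall>j\<in>{1..m}.
        (\<Oplus>\<^bsub>group_algebra G\<^esub> l\<in>{1..m} - {j}.
            set_elem (D j) \<otimes>\<^bsub>group_algebra G\<^esub> set_elem (set_inv\<^bsub>G\<^esub> (D l)))
        = complex_of_nat lam \<odot>\<^bsub>group_algebra G\<^esub>
            (set_elem (carrier G) \<ominus>\<^bsub>group_algebra G\<^esub> \<one>\<^bsub>group_algebra G\<^esub>))"

lemma group_algebra_abelian_group: "abelian_group (group_algebra G)"
proof (rule abelian_groupI)
  fix f assume f: "f \<in> carrier (group_algebra G)"
  show "\<exists>g\<in>carrier (group_algebra G). g \<oplus>\<^bsub>group_algebra G\<^esub> f = \<zero>\<^bsub>group_algebra G\<^esub>"
    by (rule bexI[of _ "\<lambda>x. - f x"]) (use f in \<open>auto simp: group_algebra_def\<close>)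
qed (auto simp: group_algebra_def add_ac)

lemma group_algebra_ring:
  fixes G (structure)
  assumes "group G" "finite (carrier G)"
  shows "ring (group_algebra G)"
proof -
  interpret group G by fact
  let ?A = "group_algebra G"
  have one: "(\<Sum>y\<in>carrier G. (if y = z then c y else 0)) = c z" if "z \<in> carrier G"
    for z and c :: "'a \<Rightarrow> complex"
    using that assms(2) by (simp add: sum.delta)
  have mon: "monoid ?A"
  proof (rule monoidI)
    fix f g h assume "f \<in> carrier ?A" "g \<in> carrier ?A" "h \<in> carrier ?A"
    show "f \<otimes>\<^bsub>?A\<^esub> g \<otimes>\<^bsub>?A\<^esub> h = f \<otimes>\<^bsub>?A\<^esub> (g \<otimes>\<^bsub>?A\<^esub> h)"
    proof
      fix x
      show "(f \<otimes>\<^bsub>?A\<^esub> g \<otimes>\<^bsub>?A\<^esub> h) x = (f \<otimes>\<^bsub>?A\<^esub> (g \<otimes>\<^bsub>?A\<^esub> h)) x"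
      proof (cases "x \<in> carrier G")
        case x: True
        have "(f \<otimes>\<^bsub>?A\<^esub> g \<otimes>\<^bsub>?A\<^esub> h) x
          = (\<Sum>z\<in>carrier G. \<Sum>y\<in>carrier G. f y * g (inv y \<otimes> z) * h (inv z \<otimes> x))"
          using x by (simp add: group_algebra_def sum_distrib_right)
        also have "\<dots> = (\<Sum>y\<in>carrier G. \<Sum>z\<in>carrier G. f y * g (inv y \<otimes> z) * h (inv z \<otimes> x))"
          by (rule sum.swap)
        also have "\<dots> = (\<Sum>y\<in>carrier G. \<Sum>w\<in>carrier G. f y * g w * h (inv w \<otimes> (inv y \<otimes> x)))"
        proof (rule sum.cong[OF refl])
          fix y assume y: "y \<in> carrier G"
          have c: "y \<otimes> (inv y \<otimes> z) = z" "inv y \<otimes> (y \<otimes> z) = z" if "z \<in> carrier G" for z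
            using y that by (simp_all flip: m_assoc)
          show "(\<Sum>z\<in>carrier G. f y * g (inv y \<otimes> z) * h (inv z \<otimes> x))
            = (\<Sum>w\<in>carrier G. f y * g w * h (inv w \<otimes> (inv y \<otimes> x)))"
            by (rule sum.reindex_bij_witness[of _ "\<lambda>w. y \<otimes> w" "\<lambda>z. inv y \<otimes> z"])
              (use x y in \<open>auto simp: inv_mult_group m_assoc c\<close>)
        qed
        also have "\<dots> = (f \<otimes>\<^bsub>?A\<^esub> (g \<otimes>\<^bsub>?A\<^esub> h)) x"
          using x by (simp add: group_algebra_def sum_distrib_left mult.assoc)
        finally show ?thesis .
      qed (simp add: group_algebra_def)
    qed
  next
    fix f assume f: "f \<in> carrier ?A"
    show "\<one>\<^bsub>?A\<^esub> \<otimes>\<^bsub>?A\<^esub> f = f"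
    proof
      fix x
      have "x \<in> carrier G \<Longrightarrow>
        (\<Sum>y\<in>carrier G. (if y = \<one> then 1 else 0) * f (inv y \<otimes> x)) = f x"
        using one[of \<one> "\<lambda>y. f (inv y \<otimes> x)"] by (simp add: if_distrib[of "\<lambda>c. c * _"] cong: if_cong)
      then show "(\<one>\<^bsub>?A\<^esub> \<otimes>\<^bsub>?A\<^esub> f) x = f x"
        using f by (auto simp: group_algebra_def)
    qed
    show "f \<otimes>\<^bsub>?A\<^esub> \<one>\<^bsub>?A\<^esub> = f"
    proof
      fix x
      have "(\<Sum>y\<in>carrier G. f y * (if inv y \<otimes> x = \<one> then 1 else 0)) = f x"
        if x: "x \<in> carrier G"
      proof -
        have "(inv y \<otimes> x = \<one>) = (y = x)" if "y \<in> carrier G" for y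
          using x that by (metis inv_closed inv_equality inv_inv l_inv)
        then have "(\<Sum>y\<in>carrier G. f y * (if inv y \<otimes> x = \<one> then 1 else 0))
          = (\<Sum>y\<in>carrier G. if y = x then f y else 0)"
          by (intro sum.cong) auto
        then show ?thesis using one[OF x, of f] by simp
      qed
      then show "(f \<otimes>\<^bsub>?A\<^esub> \<one>\<^bsub>?A\<^esub>) x = f x"
        using f by (auto simp: group_algebra_def)
    qed
  qed (auto simp: group_algebra_def)
  show ?thesis
    by (rule ringI[OF group_algebra_abelian_group mon])
      (auto simp: group_algebra_def fun_eq_iff algebra_simps sum.distrib)
qed

end

theory Submission
  imports Defs
begin

text \<open>
  Subtracting from each \<open>D\<^sub>j\<close> its average over \<open>G\<close> gives elements \<open>x\<^sub>j\<close> orthogonal to \<open>G\<close>. With \<open>*\<close> the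
  canonical involution, \<open>S = x\<^sub>1 + x\<^sub>2 + x\<^sub>3\<close>, and \<open>e\<close> the identity of the ideal of such elements, the
  defining equations read \<open>x\<^sub>j (S - x\<^sub>j)* = - \<lambda> e\<close>. Hence every \<open>u\<^sub>j = x\<^sub>j S*\<close> is self-adjoint and is a
  root of \<open>u\<^sup>2 = t u + \<lambda> t\<close>, where \<open>t = S S* = u\<^sub>1 + u\<^sub>2 + u\<^sub>3\<close>. Subtracting two of these equations gives
  \<open>(u\<^sub>i - u\<^sub>j) u\<^sub>l = 0\<close>, and \<open>x\<^sub>l\<close> is invertible in the ideal, so \<open>w = u\<^sub>j S*\<close> does not depend on \<open>j\<close>;
  the quadratic equation then becomes \<open>(2 t + 9 \<lambda>) w = 0\<close>. As \<open>t\<close> is positive semidefinite, \<open>w = 0\<close>,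
  so \<open>t S* = 3 w = 0\<close> and \<open>S = 0\<close>. Therefore the \<open>D\<^sub>j\<close> partition \<open>G\<close>, so \<open>v = 3 k\<close>, and
  \<open>2 k\<^sup>2 = \<lambda> (3 k - 1)\<close> forces \<open>k = 1\<close>. Working with the involution in place of the characters of \<open>G\<close>
  avoids Fourier analysis on \<open>G\<close>.
\<close>

section \<open>Identities in an arbitrary commutative ring\<close>

lemma (in cring) triple_quadratic:
  assumes [simp]: "x1 \<in> carrier R" "x2 \<in> carrier R" "x3 \<in> carrier R"
    "y1 \<in> carrier R" "y2 \<in> carrier R" "y3 \<in> carrier R" "L \<in> carrier R" "e \<in> carrier R"
    and S: "S = x1 \<oplus> x2 \<oplus> x3" and T: "T = y1 \<oplus> y2 \<oplus> y3" and t: "t = S \<otimes> T"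
    and eS: "e \<otimes> S = S"
    and xy: "x1 \<otimes> (y2 \<oplus> y3) = \<ominus> (L \<otimes> e)"
    and yx: "y1 \<otimes> (x2 \<oplus> x3) = \<ominus> (L \<otimes> e)"
  shows "x1 \<otimes> T \<otimes> (x1 \<otimes> T) = x1 \<otimes> T \<otimes> t \<oplus> L \<otimes> t"
proof -
  have [simp]: "S \<in> carrier R" "T \<in> carrier R" "t \<in> carrier R" by (simp_all add: S T t)
  have "x1 \<otimes> T = x1 \<otimes> y1 \<oplus> x1 \<otimes> (y2 \<oplus> y3)" unfolding T by (simp add: r_distr a_assoc)
  then have u: "x1 \<otimes> T = x1 \<otimes> y1 \<ominus> L \<otimes> e" by (simp add: xy a_minus_def)
  have "y1 \<otimes> S = y1 \<otimes> x1 \<oplus> y1 \<otimes> (x2 \<oplus> x3)" unfolding S by (simp add: r_distr a_assoc)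
  then have u': "x1 \<otimes> T = y1 \<otimes> S" by (simp add: yx u a_minus_def m_comm)
  have p: "x1 \<otimes> y1 = x1 \<otimes> T \<oplus> L \<otimes> e" unfolding u by (simp add: a_minus_def a_assoc l_neg)
  have "x1 \<otimes> T \<otimes> (x1 \<otimes> T) = x1 \<otimes> T \<otimes> (y1 \<otimes> S)" by (simp only: u')
  also have "\<dots> = x1 \<otimes> y1 \<otimes> t" unfolding t by (simp add: m_ac)
  also have "\<dots> = x1 \<otimes> T \<otimes> t \<oplus> L \<otimes> (e \<otimes> S) \<otimes> T" unfolding p
    unfolding t by (simp add: l_distr m_assoc)
  finally show ?thesis by (simp add: eS t m_assoc)
qed

text \<open>Inserting the sum \<open>t\<close> into the two quadratic equations and cancelling the
  squares gives \<open>u1 \<otimes> ?v = u2 \<otimes> ?v\<close> with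
  \<open>?v = x3 \<otimes> T\<close>. Up to the factor \<open>\<ominus> L\<close>, \<open>y\<close>
  inverts \<open>x3\<close> relative to \<open>e\<close>, so multiplying by \<open>y\<close> removes
  \<open>x3\<close>; \<open>cancel\<close> then removes \<open>L\<close>.\<close>

lemma (in cring) triple_mult_eq:
  assumes [simp]: "x3 \<in> carrier R" "T \<in> carrier R" "y \<in> carrier R"
    "u1 \<in> carrier R" "u2 \<in> carrier R" "L \<in> carrier R" "e \<in> carrier R"
    and eT: "e \<otimes> T = T"
    and cancel: "\<And>z z'. z \<in> carrier R \<Longrightarrow> z' \<in> carrier R \<Longrightarrow> L \<otimes> z = L \<otimes> z' \<Longrightarrow> z = z'"
    and xy: "x3 \<otimes> y = \<ominus> (L \<otimes> e)"
    and t: "t = u1 \<oplus> u2 \<oplus> x3 \<otimes> T"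
    and u1: "u1 \<otimes> u1 = u1 \<otimes> t \<oplus> L \<otimes> t" and u2: "u2 \<otimes> u2 = u2 \<otimes> t \<oplus> L \<otimes> t"
  shows "u1 \<otimes> T = u2 \<otimes> T"
proof -
  have [simp]: "t \<in> carrier R" by (simp add: t)
  let ?v = "x3 \<otimes> T"
  have ut: "u \<otimes> t = u \<otimes> u1 \<oplus> (u \<otimes> u2 \<oplus> u \<otimes> ?v)" if "u \<in> carrier R" for u
    unfolding t using that by (simp add: r_distr a_assoc)
  have "u1 \<otimes> u1 = u1 \<otimes> u1 \<oplus> (u1 \<otimes> u2 \<oplus> L \<otimes> t \<oplus> u1 \<otimes> ?v)"
    by (subst (1) u1, subst (1) ut) (simp_all add: a_ac)
  then have "u1 \<otimes> u2 \<oplus> L \<otimes> t \<oplus> u1 \<otimes> ?v = \<zero>" by simp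
  moreover have "u2 \<otimes> u2 = u2 \<otimes> u2 \<oplus> (u1 \<otimes> u2 \<oplus> L \<otimes> t \<oplus> u2 \<otimes> ?v)"
    by (subst (1) u2, subst (1) ut) (simp_all add: a_ac m_comm[of u2 u1])
  \<comment> \<open>The two vanishing expressions share
    \<open>u1 \<otimes> u2 \<oplus> L \<otimes> t\<close>, so only the products with
    \<open>?v\<close> remain to be compared.\<close>
  then have "u1 \<otimes> u2 \<oplus> L \<otimes> t \<oplus> u2 \<otimes> ?v = \<zero>" by simp
  ultimately have "u1 \<otimes> u2 \<oplus> L \<otimes> t \<oplus> u1 \<otimes> ?v = u1 \<otimes> u2 \<oplus> L \<otimes> t \<oplus> u2 \<otimes> ?v"
    by simp
  then have "u1 \<otimes> ?v \<otimes> y = u2 \<otimes> ?v \<otimes> y" by simp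
  moreover have "u \<otimes> ?v \<otimes> y = \<ominus> (L \<otimes> (u \<otimes> T))" if [simp]: "u \<in> carrier R" for u
  proof -
    have "u \<otimes> ?v \<otimes> y = u \<otimes> T \<otimes> (x3 \<otimes> y)" by (simp add: m_ac)
    also have "\<dots> = \<ominus> (L \<otimes> (u \<otimes> (e \<otimes> T)))" unfolding xy by (simp add: m_ac r_minus)
    finally show ?thesis by (simp add: eT)
  qed
  ultimately have "\<ominus> (\<ominus> (L \<otimes> (u1 \<otimes> T))) = \<ominus> (\<ominus> (L \<otimes> (u2 \<otimes> T)))" by simp
  then have "L \<otimes> (u1 \<otimes> T) = L \<otimes> (u2 \<otimes> T)" by (simp only: minus_minus assms(1-6) m_closed)
  then show ?thesis by (rule cancel[rotated 2]) auto
qed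

text \<open>All \<open>u\<close> act on \<open>w\<close> alike, so \<open>t \<otimes> w\<close> is
  three times \<open>u1 \<otimes> w\<close>. Multiplying the quadratic equation by \<open>T\<close>
  gives 2 u1 w + 3 L w = 0, and three times this is the second claim. The multiples 2, 3 and 9 are
  spelled out as repeated sums.\<close>

lemma (in cring) triple_collapse:
  assumes [simp]: "u1 \<in> carrier R" "u2 \<in> carrier R" "u3 \<in> carrier R" "T \<in> carrier R" "L \<in> carrier R"
    and t: "t = u1 \<oplus> u2 \<oplus> u3"
    and u: "u1 \<otimes> u1 = u1 \<otimes> t \<oplus> L \<otimes> t"
    and u12: "u1 \<otimes> T = u2 \<otimes> T" and u13: "u1 \<otimes> T = u3 \<otimes> T"
    and w: "w = u1 \<otimes> T"
  shows "t \<otimes> T = w \<oplus> w \<oplus> w"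
    and "t \<otimes> w \<oplus> t \<otimes> w \<oplus> (L \<oplus> L \<oplus> L \<oplus> (L \<oplus> L \<oplus> L) \<oplus> (L \<oplus> L \<oplus> L)) \<otimes> w = \<zero>"
proof -
  have [simp]: "t \<in> carrier R" "w \<in> carrier R" by (simp_all add: t w)
  show tT: "t \<otimes> T = w \<oplus> w \<oplus> w" unfolding t w using u12 u13 by (simp add: l_distr)
  have "u1 \<otimes> w = u1 \<otimes> (u2 \<otimes> T)" "u1 \<otimes> w = u1 \<otimes> (u3 \<otimes> T)" using w u12 u13 by simp_all
  \<comment> \<open>Commutativity: u2 w = u2 (u1 T) = u1 (u2 T) = u1 w, and likewise for
    \<open>u3\<close>.\<close>
  then have uw: "u2 \<otimes> w = u1 \<otimes> w" "u3 \<otimes> w = u1 \<otimes> w" unfolding w by (simp_all add: m_ac)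
  have tw: "t \<otimes> w = u1 \<otimes> w \<oplus> u1 \<otimes> w \<oplus> u1 \<otimes> w" unfolding t by (simp add: l_distr uw)
  have "u1 \<otimes> w = (u1 \<otimes> u1) \<otimes> T" unfolding w by (simp add: m_assoc)
  also have "\<dots> = (u1 \<oplus> L) \<otimes> (t \<otimes> T)" unfolding u by (simp add: l_distr m_assoc)
  also have "\<dots> = u1 \<otimes> w \<oplus> (u1 \<otimes> w \<oplus> u1 \<otimes> w \<oplus> (L \<oplus> L \<oplus> L) \<otimes> w)" unfolding tT by (simp add: l_distr r_distr a_ac)
  finally have "u1 \<otimes> w \<oplus> u1 \<otimes> w \<oplus> (L \<oplus> L \<oplus> L) \<otimes> w = \<zero>"
    by (metis add.r_cancel_one' \<open>u1 \<in> carrier R\<close> \<open>L \<in> carrier R\<close> \<open>w \<in> carrier R\<close> a_closed m_closed add.l_cancel_one')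
  moreover have "t \<otimes> w \<oplus> t \<otimes> w \<oplus> (L \<oplus> L \<oplus> L \<oplus> (L \<oplus> L \<oplus> L) \<oplus> (L \<oplus> L \<oplus> L)) \<otimes> w
     = (u1 \<otimes> w \<oplus> u1 \<otimes> w \<oplus> (L \<oplus> L \<oplus> L) \<otimes> w) \<oplus> (u1 \<otimes> w \<oplus> u1 \<otimes> w \<oplus> (L \<oplus> L \<oplus> L) \<otimes> w) \<oplus> (u1 \<otimes> w \<oplus> u1 \<otimes> w \<oplus> (L \<oplus> L \<oplus> L) \<otimes> w)"
    unfolding tw by (simp add: l_distr r_distr a_ac)
  ultimately show "t \<otimes> w \<oplus> t \<otimes> w \<oplus> (L \<oplus> L \<oplus> L \<oplus> (L \<oplus> L \<oplus> L) \<oplus> (L \<oplus> L \<oplus> L)) \<otimes> w = \<zero>"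
    by simp
qed

section \<open>Coefficients in the group algebra and the involution\<close>

lemma carrier_group_algebra:
  "f \<in> carrier (group_algebra G) \<longleftrightarrow> (\<forall>x. x \<notin> carrier G \<longrightarrow> f x = 0)"
  by (simp add: group_algebra_def)

lemma mult_group_algebra:
  "x \<in> carrier G \<Longrightarrow> (f \<otimes>\<^bsub>group_algebra G\<^esub> g) x = (\<Sum>y\<in>carrier G. f y * g (inv\<^bsub>G\<^esub> y \<otimes>\<^bsub>G\<^esub> x))"
  by (simp add: group_algebra_def)

lemma add_group_algebra [simp]: "(f \<oplus>\<^bsub>group_algebra G\<^esub> g) x = f x + g x"
  by (simp add: group_algebra_def)

lemma zero_group_algebra [simp]: "\<zero>\<^bsub>group_algebra G\<^esub> x = 0"
  by (simp add: group_algebra_def)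

lemma one_group_algebra: "\<one>\<^bsub>group_algebra G\<^esub> x = (if x = \<one>\<^bsub>G\<^esub> then 1 else 0)"
  by (simp add: group_algebra_def)

lemma smult_group_algebra [simp]: "(c \<odot>\<^bsub>group_algebra G\<^esub> f) x = c * f x"
  by (simp add: group_algebra_def)

lemma a_inv_group_algebra [simp]:
  assumes "f \<in> carrier (group_algebra G)"
  shows "(\<ominus>\<^bsub>group_algebra G\<^esub> f) x = - f x"
proof -
  interpret abelian_group "group_algebra G" by (rule group_algebra_abelian_group)
  have "(f \<oplus>\<^bsub>group_algebra G\<^esub> (\<ominus>\<^bsub>group_algebra G\<^esub> f)) x = 0"
    using assms by (simp del: add_group_algebra add: r_neg)
  then show ?thesis by (simp add: eq_neg_iff_add_eq_0 add.commute)
qed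

lemma group_algebra_eqI:
  assumes "f \<in> carrier (group_algebra G)" "g \<in> carrier (group_algebra G)"
    and "\<And>x. x \<in> carrier G \<Longrightarrow> f x = g x"
  shows "f = g"
  using assms by (force simp: carrier_group_algebra)

text \<open>The conjugate-linear extension of group inversion; on character values it acts as
  complex conjugation. The value \<open>0\<close> off the carrier keeps the result in the
  algebra.\<close>

definition star :: "('a, 'b) monoid_scheme \<Rightarrow> ('a \<Rightarrow> complex) \<Rightarrow> 'a \<Rightarrow> complex" where
  "star G f = (\<lambda>x. if x \<in> carrier G then cnj (f (inv\<^bsub>G\<^esub> x)) else 0)"

lemma star_closed [simp]: "star G f \<in> carrier (group_algebra G)"
  by (simp add: star_def carrier_group_algebra)

section \<open>Commutativity and positivity of the group algebra\<close>

locale finite_comm_group = comm_group +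
  assumes finite_carrier: "finite (carrier G)"
begin

abbreviation A where "A \<equiv> group_algebra G"

lemma cancel_inv:
  assumes "x \<in> carrier G" "y \<in> carrier G"
  shows "x \<otimes> (inv x \<otimes> y) = y" "inv x \<otimes> (x \<otimes> y) = y"
  using assms by (simp_all flip: m_assoc)

text \<open>This change of variable exchanges the two arguments of a convolution and turns the sum
  of a shifted indicator into a cardinality.\<close>

lemma bij_inv_mult: "x \<in> carrier G \<Longrightarrow> bij_betw (\<lambda>y. inv y \<otimes> x) (carrier G) (carrier G)"
  by (rule bij_betwI[of _ _ _ "\<lambda>y. x \<otimes> inv y"])
    (auto simp: inv_mult_group cancel_inv m_assoc)

lemma group_algebra_cring: "cring A"
proof -
  interpret R: ring A by (rule group_algebra_ring[OF is_group finite_carrier])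
  show ?thesis
  proof (intro cringI R.abelian_group_axioms comm_monoidI)
    fix f g assume fg: "f \<in> carrier A" "g \<in> carrier A"
    show "f \<otimes>\<^bsub>A\<^esub> g = g \<otimes>\<^bsub>A\<^esub> f"
    proof (rule group_algebra_eqI)
      fix x assume x: "x \<in> carrier G"
      have "(\<Sum>y\<in>carrier G. f y * g (inv y \<otimes> x)) = (\<Sum>y\<in>carrier G. f (inv y \<otimes> x) * g (inv (inv y \<otimes> x) \<otimes> x))"
        by (rule sum.reindex_bij_betw[symmetric, OF bij_inv_mult[OF x]])
      also have "\<dots> = (\<Sum>y\<in>carrier G. g y * f (inv y \<otimes> x))"
      proof (rule sum.cong[OF refl])
        fix y assume y: "y \<in> carrier G"
        then have "inv (inv y \<otimes> x) \<otimes> x = y" using x by (simp add: inv_mult_group m_comm[of "inv x"] m_assoc)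
        then show "f (inv y \<otimes> x) * g (inv (inv y \<otimes> x) \<otimes> x) = g y * f (inv y \<otimes> x)" by simp
      qed
      finally show "(f \<otimes>\<^bsub>A\<^esub> g) x = (g \<otimes>\<^bsub>A\<^esub> f) x" using x by (simp add: mult_group_algebra)
    qed (use fg in auto)
  qed (auto simp: R.m_assoc R.l_distr)
qed

sublocale A: cring A by (rule group_algebra_cring)

text \<open>The involution reverses products in general; commutativity of the group lets the order
  stand.\<close>

lemma star_mult: "star G (f \<otimes>\<^bsub>A\<^esub> g) = star G f \<otimes>\<^bsub>A\<^esub> star G g"
proof
  fix x
  show "star G (f \<otimes>\<^bsub>A\<^esub> g) x = (star G f \<otimes>\<^bsub>A\<^esub> star G g) x"
  proof (cases "x \<in> carrier G")
    case x: True
    have "(star G f \<otimes>\<^bsub>A\<^esub> star G g) x = (\<Sum>y\<in>carrier G. cnj (f (inv y)) * cnj (g (inv (inv y \<otimes> x))))"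
      using x by (simp add: mult_group_algebra star_def)
    also have "\<dots> = (\<Sum>y\<in>carrier G. cnj (f y) * cnj (g (inv y \<otimes> inv x)))"
      by (rule sum.reindex_bij_witness[of _ "\<lambda>y. inv y" "\<lambda>y. inv y"])
        (use x in \<open>auto simp: inv_mult_group m_comm\<close>)
    finally show ?thesis using x by (simp add: star_def mult_group_algebra)
  qed (simp add: star_def group_algebra_def)
qed

lemma star_add: "star G (f \<oplus>\<^bsub>A\<^esub> g) = star G f \<oplus>\<^bsub>A\<^esub> star G g"
  by (auto simp: star_def)

lemma star_star: "f \<in> carrier A \<Longrightarrow> star G (star G f) = f"
  by (auto simp: star_def carrier_group_algebra)

text \<open>The coefficient at the identity is a squared norm. All positivity used below comes from
  this formula.\<close>

lemma mult_star_one: "(f \<otimes>\<^bsub>A\<^esub> star G f) \<one> = of_real (\<Sum>y\<in>carrier G. (cmod (f y))\<^sup>2)"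
  by (simp add: mult_group_algebra star_def complex_norm_square del: of_real_power)

lemma mult_star_eq_zero:
  assumes "f \<in> carrier A" "f \<otimes>\<^bsub>A\<^esub> star G f = \<zero>\<^bsub>A\<^esub>"
  shows "f = \<zero>\<^bsub>A\<^esub>"
proof -
  have "(\<Sum>y\<in>carrier G. (cmod (f y))\<^sup>2) = 0"
    using mult_star_one[of f] assms(2) by (simp del: of_real_sum)
  then have "\<forall>y\<in>carrier G. f y = 0"
    using finite_carrier by (simp add: sum_nonneg_eq_0_iff)
  then show ?thesis by (intro group_algebra_eqI) (use assms in auto)
qed

text \<open>With \<open>?t\<close> the product of \<open>f\<close> and \<open>star G f\<close>, the
  product of \<open>?t\<close> and its adjoint contains the vanishing expression as a factor.
  Definiteness of the norm applies first to \<open>?t\<close>, then to \<open>f\<close>.\<close>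

lemma square_star_eq_zero:
  assumes f: "f \<in> carrier A" and eq: "f \<otimes>\<^bsub>A\<^esub> star G f \<otimes>\<^bsub>A\<^esub> star G f = \<zero>\<^bsub>A\<^esub>"
  shows "f = \<zero>\<^bsub>A\<^esub>"
proof -
  let ?t = "f \<otimes>\<^bsub>A\<^esub> star G f"
  have "?t \<otimes>\<^bsub>A\<^esub> star G ?t = ?t \<otimes>\<^bsub>A\<^esub> star G f \<otimes>\<^bsub>A\<^esub> f"
    using f by (simp add: star_mult star_star A.m_assoc)
  then have "?t \<otimes>\<^bsub>A\<^esub> star G ?t = \<zero>\<^bsub>A\<^esub>" unfolding eq using f by simp
  then have "?t = \<zero>\<^bsub>A\<^esub>" by (rule mult_star_eq_zero[rotated]) (use f in simp)
  then show ?thesis using f by (rule mult_star_eq_zero[rotated])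
qed

text \<open>Turns scalars into ring elements, so that the ring identities apply with \<lambda> as an
  element of the algebra.\<close>

lemma smult_one_mult:
  assumes "f \<in> carrier A"
  shows "(c \<odot>\<^bsub>A\<^esub> \<one>\<^bsub>A\<^esub>) \<otimes>\<^bsub>A\<^esub> f = c \<odot>\<^bsub>A\<^esub> f"
proof (rule group_algebra_eqI)
  fix x assume x: "x \<in> carrier G"
  have "((c \<odot>\<^bsub>A\<^esub> \<one>\<^bsub>A\<^esub>) \<otimes>\<^bsub>A\<^esub> f) x = c * (\<one>\<^bsub>A\<^esub> \<otimes>\<^bsub>A\<^esub> f) x"
    using x by (simp add: mult_group_algebra sum_distrib_left mult.assoc)
  then show "((c \<odot>\<^bsub>A\<^esub> \<one>\<^bsub>A\<^esub>) \<otimes>\<^bsub>A\<^esub> f) x = (c \<odot>\<^bsub>A\<^esub> f) x"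
    using assms by simp
qed (use assms in \<open>auto simp: group_algebra_def\<close>)

text \<open>Multiplying by \<open>star G w\<close> and reading the coefficient at the identity gives
  |f w|^2 + c |w|^2 = 0 for the norm above, a sum of nonnegative terms.\<close>

lemma positive_cancel:
  assumes f: "f \<in> carrier A" and w: "w \<in> carrier A" and c: "c > 0"
    and eq: "f \<otimes>\<^bsub>A\<^esub> star G f \<otimes>\<^bsub>A\<^esub> w \<oplus>\<^bsub>A\<^esub> complex_of_real c \<odot>\<^bsub>A\<^esub> w = \<zero>\<^bsub>A\<^esub>"
  shows "w = \<zero>\<^bsub>A\<^esub>"
proof -
  let ?c = "complex_of_real c \<odot>\<^bsub>A\<^esub> \<one>\<^bsub>A\<^esub>"
  have cA: "?c \<in> carrier A" by (simp add: carrier_group_algebra one_group_algebra)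
  have "\<zero>\<^bsub>A\<^esub> = (f \<otimes>\<^bsub>A\<^esub> star G f \<otimes>\<^bsub>A\<^esub> w \<oplus>\<^bsub>A\<^esub> ?c \<otimes>\<^bsub>A\<^esub> w) \<otimes>\<^bsub>A\<^esub> star G w"
    using eq w by (simp add: smult_one_mult)
  also have "\<dots> = (f \<otimes>\<^bsub>A\<^esub> w) \<otimes>\<^bsub>A\<^esub> star G (f \<otimes>\<^bsub>A\<^esub> w) \<oplus>\<^bsub>A\<^esub> ?c \<otimes>\<^bsub>A\<^esub> (w \<otimes>\<^bsub>A\<^esub> star G w)"
    using f w cA by (simp add: star_mult A.l_distr) (simp add: A.m_ac)
  also have "\<dots> = (f \<otimes>\<^bsub>A\<^esub> w) \<otimes>\<^bsub>A\<^esub> star G (f \<otimes>\<^bsub>A\<^esub> w) \<oplus>\<^bsub>A\<^esub> c \<odot>\<^bsub>A\<^esub> (w \<otimes>\<^bsub>A\<^esub> star G w)"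
    using w by (simp add: smult_one_mult)
  finally have "(\<zero>\<^bsub>A\<^esub> :: 'a \<Rightarrow> complex) \<one> = \<dots> \<one>" by (rule fun_cong)
  then have "complex_of_real ((\<Sum>y\<in>carrier G. (cmod ((f \<otimes>\<^bsub>A\<^esub> w) y))\<^sup>2) + c * (\<Sum>y\<in>carrier G. (cmod (w y))\<^sup>2)) = 0"
    by (simp add: mult_star_one del: of_real_sum)
  then have "(\<Sum>y\<in>carrier G. (cmod ((f \<otimes>\<^bsub>A\<^esub> w) y))\<^sup>2) + c * (\<Sum>y\<in>carrier G. (cmod (w y))\<^sup>2) = 0"
    by (simp only: of_real_eq_0_iff)
  moreover have "(\<Sum>y\<in>carrier G. (cmod ((f \<otimes>\<^bsub>A\<^esub> w) y))\<^sup>2) \<ge> 0" "c * (\<Sum>y\<in>carrier G. (cmod (w y))\<^sup>2) \<ge> 0"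
    using c by (auto intro!: sum_nonneg mult_nonneg_nonneg)
  ultimately have "(\<Sum>y\<in>carrier G. (cmod (w y))\<^sup>2) = 0" using c by (simp add: add_nonneg_eq_0_iff)
  then have "\<forall>y\<in>carrier G. w y = 0"
    using finite_carrier by (simp add: sum_nonneg_eq_0_iff)
  then show ?thesis by (intro group_algebra_eqI) (use w in auto)
qed

end

section \<open>Projection to the elements with coefficient sum zero\<close>

text \<open>For a subset \<open>S\<close> of the group this is \<open>S\<close> times the idempotent
  1 - G/v; it gives the elements x_j of the overview, and for \<open>S = {\<one>}\<close> the
  idempotent itself, called \<open>e\<close>.\<close>

definition centred :: "('a, 'b) monoid_scheme \<Rightarrow> 'a set \<Rightarrow> 'a \<Rightarrow> complex" where
  "centred G S = (\<lambda>x. if x \<in> carrier G then set_elem S x - of_nat (card S) / of_nat (order G) else 0)"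

lemma centred_closed [simp]: "centred G S \<in> carrier (group_algebra G)"
  by (simp add: centred_def carrier_group_algebra)

lemma set_elem_closed: "S \<subseteq> carrier G \<Longrightarrow> set_elem S \<in> carrier (group_algebra G)"
  by (auto simp: set_elem_def carrier_group_algebra)

context finite_comm_group
begin

lemma order_pos: "order G > 0"
  using finite_carrier by (simp add: order_gt_0_iff_finite)

lemma sum_set_elem: "S \<subseteq> carrier G \<Longrightarrow> (\<Sum>y\<in>carrier G. set_elem S y) = of_nat (card S)"
  using finite_carrier by (simp add: set_elem_def sum.If_cases Int_absorb1)

text \<open>Each of the two mixed terms contributes -|S||T|/v and the product of the averages
  contributes +|S||T|/v, which leaves a single constant.\<close>

lemma mult_centred:
  assumes "S \<subseteq> carrier G" "T \<subseteq> carrier G" and x: "x \<in> carrier G"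
  shows "(centred G S \<otimes>\<^bsub>A\<^esub> centred G T) x =
    (set_elem S \<otimes>\<^bsub>A\<^esub> set_elem T) x - of_nat (card S) * of_nat (card T) / of_nat (order G)"
proof -
  define s t :: complex where st: "s = of_nat (card S) / of_nat (order G)" "t = of_nat (card T) / of_nat (order G)"
  have T: "(\<Sum>y\<in>carrier G. set_elem T (inv y \<otimes> x)) = of_nat (card T)"
    using sum.reindex_bij_betw[OF bij_inv_mult[OF x], of "set_elem T :: _ \<Rightarrow> complex"] assms(2)
    by (simp add: sum_set_elem)
  have "(centred G S \<otimes>\<^bsub>A\<^esub> centred G T) x =
      (\<Sum>y\<in>carrier G. (set_elem S y - s) * (set_elem T (inv y \<otimes> x) - t))"
    using x by (simp add: mult_group_algebra centred_def st)
  also have "\<dots> = (\<Sum>y\<in>carrier G. set_elem S y * set_elem T (inv y \<otimes> x))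
      - t * (\<Sum>y\<in>carrier G. set_elem S y) - s * (\<Sum>y\<in>carrier G. set_elem T (inv y \<otimes> x))
      + of_nat (order G) * (s * t)"
    by (simp add: algebra_simps sum.distrib sum_subtractf sum_distrib_left order_def)
  also have "\<dots> = (set_elem S \<otimes>\<^bsub>A\<^esub> set_elem T) x - of_nat (card S) * of_nat (card T) / of_nat (order G)"
    using x T assms order_pos by (simp add: sum_set_elem mult_group_algebra st)
  finally show ?thesis .
qed

lemma set_inv_memb: "S \<subseteq> carrier G \<Longrightarrow> x \<in> carrier G \<Longrightarrow> x \<in> set_inv S \<longleftrightarrow> inv x \<in> S"
  by (force simp: SET_INV_def)

lemma set_inv_subset: "S \<subseteq> carrier G \<Longrightarrow> set_inv S \<subseteq> carrier G"
  by (auto simp: SET_INV_def)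

lemma card_set_inv:
  assumes "S \<subseteq> carrier G"
  shows "card (set_inv S) = card S"
proof -
  have "set_inv S = (\<lambda>x. inv x) ` S" by (auto simp: SET_INV_def)
  moreover have "inj_on (\<lambda>x. inv x) S" using assms inv_inj by (rule inj_on_subset[rotated])
  ultimately show ?thesis by (simp add: card_image)
qed

text \<open>Real coefficients are unchanged by conjugation, so the involution only inverts the set.
  This links the inverse sets in the definition of an SEDF to adjoints.\<close>

lemma star_centred: "S \<subseteq> carrier G \<Longrightarrow> star G (centred G S) = centred G (set_inv S)"
  by (auto simp: star_def centred_def set_elem_def set_inv_memb card_set_inv)

lemma set_elem_one: "set_elem {\<one>} = \<one>\<^bsub>A\<^esub>"
  by (auto simp: set_elem_def one_group_algebra)

lemma centred_one_mult:
  assumes "S \<subseteq> carrier G"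
  shows "centred G {\<one>} \<otimes>\<^bsub>A\<^esub> centred G S = centred G S"
proof (rule group_algebra_eqI)
  fix x assume x: "x \<in> carrier G"
  show "(centred G {\<one>} \<otimes>\<^bsub>A\<^esub> centred G S) x = centred G S x"
    using x assms by (simp add: mult_centred set_elem_one set_elem_closed) (simp add: centred_def)
qed auto

text \<open>Supplies the three ring identities with adjoints for the \<open>y\<close> variables,
  then uses positivity to pass from \<open>w = \<zero>\<close> to a vanishing sum.\<close>

lemma centred_triple_sum_eq_zero:
  assumes sub: "B1 \<subseteq> carrier G" "B2 \<subseteq> carrier G" "B3 \<subseteq> carrier G" and lam: "lam > 0"
    and prod1: "centred G B1 \<otimes>\<^bsub>A\<^esub> (star G (centred G B2) \<oplus>\<^bsub>A\<^esub> star G (centred G B3)) =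
      \<ominus>\<^bsub>A\<^esub> (complex_of_real lam \<odot>\<^bsub>A\<^esub> centred G {\<one>})"
    and prod2: "centred G B2 \<otimes>\<^bsub>A\<^esub> (star G (centred G B1) \<oplus>\<^bsub>A\<^esub> star G (centred G B3)) =
      \<ominus>\<^bsub>A\<^esub> (complex_of_real lam \<odot>\<^bsub>A\<^esub> centred G {\<one>})"
    and prod3: "centred G B3 \<otimes>\<^bsub>A\<^esub> (star G (centred G B1) \<oplus>\<^bsub>A\<^esub> star G (centred G B2)) =
      \<ominus>\<^bsub>A\<^esub> (complex_of_real lam \<odot>\<^bsub>A\<^esub> centred G {\<one>})"
  shows "centred G B1 \<oplus>\<^bsub>A\<^esub> centred G B2 \<oplus>\<^bsub>A\<^esub> centred G B3 = \<zero>\<^bsub>A\<^esub>"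
proof -
  define e where "e = centred G {\<one>}"
  define L where "L = complex_of_real lam \<odot>\<^bsub>A\<^esub> \<one>\<^bsub>A\<^esub>"
  define x1 x2 x3 where x: "x1 = centred G B1" "x2 = centred G B2" "x3 = centred G B3"
  define y1 y2 y3 where y: "y1 = star G x1" "y2 = star G x2" "y3 = star G x3"
  define S where "S = x1 \<oplus>\<^bsub>A\<^esub> x2 \<oplus>\<^bsub>A\<^esub> x3"
  define T where "T = y1 \<oplus>\<^bsub>A\<^esub> y2 \<oplus>\<^bsub>A\<^esub> y3"
  define t where "t = S \<otimes>\<^bsub>A\<^esub> T"
  have [simp]: "e \<in> carrier A" "L \<in> carrier A" "x1 \<in> carrier A" "x2 \<in> carrier A" "x3 \<in> carrier A"
    "y1 \<in> carrier A" "y2 \<in> carrier A" "y3 \<in> carrier A"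
    by (simp_all add: e_def L_def x y carrier_group_algebra[of "_ \<odot>\<^bsub>A\<^esub> _"] one_group_algebra)
  have [simp]: "S \<in> carrier A" "T \<in> carrier A" "t \<in> carrier A"
    by (simp_all add: S_def T_def t_def)
  have sy: "star G y1 = x1" "star G y2 = x2" "star G y3 = x3" by (simp_all add: y star_star)
  have T_star: "T = star G S" by (simp add: S_def T_def y star_add)
  have Lf: "L \<otimes>\<^bsub>A\<^esub> f = complex_of_real lam \<odot>\<^bsub>A\<^esub> f" if "f \<in> carrier A" for f
    using that by (simp add: L_def smult_one_mult)
  have ex: "e \<otimes>\<^bsub>A\<^esub> x1 = x1" "e \<otimes>\<^bsub>A\<^esub> x2 = x2" "e \<otimes>\<^bsub>A\<^esub> x3 = x3"
    using sub by (simp_all add: e_def x centred_one_mult)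
  have star_e: "star G e = e"
    by (simp add: e_def star_centred) (simp add: SET_INV_def)
  have eS: "e \<otimes>\<^bsub>A\<^esub> S = S" by (simp add: S_def A.r_distr ex)
  have eT: "e \<otimes>\<^bsub>A\<^esub> T = T" using star_mult[of e S] by (simp add: eS star_e T_star)
  have p: "x1 \<otimes>\<^bsub>A\<^esub> (y2 \<oplus>\<^bsub>A\<^esub> y3) = \<ominus>\<^bsub>A\<^esub> (L \<otimes>\<^bsub>A\<^esub> e)" "x2 \<otimes>\<^bsub>A\<^esub> (y1 \<oplus>\<^bsub>A\<^esub> y3) = \<ominus>\<^bsub>A\<^esub> (L \<otimes>\<^bsub>A\<^esub> e)"
    "x3 \<otimes>\<^bsub>A\<^esub> (y1 \<oplus>\<^bsub>A\<^esub> y2) = \<ominus>\<^bsub>A\<^esub> (L \<otimes>\<^bsub>A\<^esub> e)"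
    using prod1 prod2 prod3 by (simp_all add: Lf flip: x y e_def)
  \<comment> \<open>The right-hand side of the product equations is self-adjoint because
    \<open>lam\<close> is real and \<open>e\<close> is fixed by the involution.\<close>
  have "star G (\<ominus>\<^bsub>A\<^esub> (L \<otimes>\<^bsub>A\<^esub> e)) = \<ominus>\<^bsub>A\<^esub> (L \<otimes>\<^bsub>A\<^esub> star G e)"
  proof (rule group_algebra_eqI)
    fix g assume g: "g \<in> carrier G"
    then have "star G (\<ominus>\<^bsub>A\<^esub> (L \<otimes>\<^bsub>A\<^esub> e)) g = - cnj ((L \<otimes>\<^bsub>A\<^esub> e) (inv g))" by (simp add: star_def)
    moreover have "(\<ominus>\<^bsub>A\<^esub> (L \<otimes>\<^bsub>A\<^esub> star G e)) g = - (L \<otimes>\<^bsub>A\<^esub> star G e) g" by simp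
    ultimately show "star G (\<ominus>\<^bsub>A\<^esub> (L \<otimes>\<^bsub>A\<^esub> e)) g = (\<ominus>\<^bsub>A\<^esub> (L \<otimes>\<^bsub>A\<^esub> star G e)) g"
      using g by (simp add: Lf) (simp add: star_def)
  qed simp_all
  then have star_Le: "star G (\<ominus>\<^bsub>A\<^esub> (L \<otimes>\<^bsub>A\<^esub> e)) = \<ominus>\<^bsub>A\<^esub> (L \<otimes>\<^bsub>A\<^esub> e)" by (simp add: star_e)
  \<comment> \<open>The adjoints of the equations \<open>p\<close>, which are the second family of
    hypotheses of \<open>triple_quadratic\<close>.\<close>
  have q: "y1 \<otimes>\<^bsub>A\<^esub> (x2 \<oplus>\<^bsub>A\<^esub> x3) = \<ominus>\<^bsub>A\<^esub> (L \<otimes>\<^bsub>A\<^esub> e)" "y2 \<otimes>\<^bsub>A\<^esub> (x1 \<oplus>\<^bsub>A\<^esub> x3) = \<ominus>\<^bsub>A\<^esub> (L \<otimes>\<^bsub>A\<^esub> e)"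
    "y3 \<otimes>\<^bsub>A\<^esub> (x1 \<oplus>\<^bsub>A\<^esub> x2) = \<ominus>\<^bsub>A\<^esub> (L \<otimes>\<^bsub>A\<^esub> e)"
    using p[THEN arg_cong[of _ _ "star G"]] by (simp_all add: star_mult star_add sy star_Le flip: y)
  have cancel: "z = z'" if z: "z \<in> carrier A" "z' \<in> carrier A" and eq: "L \<otimes>\<^bsub>A\<^esub> z = L \<otimes>\<^bsub>A\<^esub> z'" for z z'
  proof
    fix g show "z g = z' g" using fun_cong[OF eq, of g] lam z by (simp add: Lf)
  qed
  have u1: "x1 \<otimes>\<^bsub>A\<^esub> T \<otimes>\<^bsub>A\<^esub> (x1 \<otimes>\<^bsub>A\<^esub> T) = x1 \<otimes>\<^bsub>A\<^esub> T \<otimes>\<^bsub>A\<^esub> t \<oplus>\<^bsub>A\<^esub> L \<otimes>\<^bsub>A\<^esub> t"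
    by (rule A.triple_quadratic[of x1 x2 x3 y1 y2 y3 L e S T t])
      (simp_all add: eS p q, simp_all add: S_def T_def t_def)
  have u2: "x2 \<otimes>\<^bsub>A\<^esub> T \<otimes>\<^bsub>A\<^esub> (x2 \<otimes>\<^bsub>A\<^esub> T) = x2 \<otimes>\<^bsub>A\<^esub> T \<otimes>\<^bsub>A\<^esub> t \<oplus>\<^bsub>A\<^esub> L \<otimes>\<^bsub>A\<^esub> t"
    by (rule A.triple_quadratic[of x2 x1 x3 y2 y1 y3 L e S T t])
      (simp_all add: eS p q, simp_all add: S_def T_def t_def A.a_ac)
  have u3: "x3 \<otimes>\<^bsub>A\<^esub> T \<otimes>\<^bsub>A\<^esub> (x3 \<otimes>\<^bsub>A\<^esub> T) = x3 \<otimes>\<^bsub>A\<^esub> T \<otimes>\<^bsub>A\<^esub> t \<oplus>\<^bsub>A\<^esub> L \<otimes>\<^bsub>A\<^esub> t"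
    by (rule A.triple_quadratic[of x3 x1 x2 y3 y1 y2 L e S T t])
      (simp_all add: eS p q, simp_all add: S_def T_def t_def A.a_ac)
  have t_sum: "t = x1 \<otimes>\<^bsub>A\<^esub> T \<oplus>\<^bsub>A\<^esub> x2 \<otimes>\<^bsub>A\<^esub> T \<oplus>\<^bsub>A\<^esub> x3 \<otimes>\<^bsub>A\<^esub> T"
    by (simp add: t_def S_def A.l_distr)
  have u12: "x1 \<otimes>\<^bsub>A\<^esub> T \<otimes>\<^bsub>A\<^esub> T = x2 \<otimes>\<^bsub>A\<^esub> T \<otimes>\<^bsub>A\<^esub> T"
    by (rule A.triple_mult_eq[OF _ _ _ _ _ _ _ eT cancel p(3) t_sum u1 u2]) simp_all
  \<comment> \<open>The same argument with indices 2 and 3 exchanged: now \<open>x2\<close> is the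
    factor to be removed.\<close>
  have u13: "x1 \<otimes>\<^bsub>A\<^esub> T \<otimes>\<^bsub>A\<^esub> T = x3 \<otimes>\<^bsub>A\<^esub> T \<otimes>\<^bsub>A\<^esub> T"
    by (rule A.triple_mult_eq[OF _ _ _ _ _ _ _ eT cancel p(2) _ u1 u3]) (simp_all add: t_sum A.a_ac)
  define w where "w = x1 \<otimes>\<^bsub>A\<^esub> T \<otimes>\<^bsub>A\<^esub> T"
  have w [simp]: "w \<in> carrier A" by (simp add: w_def)
  note fin = A.triple_collapse[OF _ _ _ _ _ t_sum u1 u12 u13 w_def, simplified]
  have "w = \<zero>\<^bsub>A\<^esub>"
  proof (rule positive_cancel)
    \<comment> \<open>The relation 2 t w + 9 L w = 0 is halved, whence the constant 9/2.\<close>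
    show "S \<otimes>\<^bsub>A\<^esub> star G S \<otimes>\<^bsub>A\<^esub> w \<oplus>\<^bsub>A\<^esub> complex_of_real (9 / 2 * lam) \<odot>\<^bsub>A\<^esub> w = \<zero>\<^bsub>A\<^esub>"
    proof
      fix g
      show "(S \<otimes>\<^bsub>A\<^esub> star G S \<otimes>\<^bsub>A\<^esub> w \<oplus>\<^bsub>A\<^esub> complex_of_real (9 / 2 * lam) \<odot>\<^bsub>A\<^esub> w) g = \<zero>\<^bsub>A\<^esub> g"
        using fun_cong[OF fin(2), of g] by (simp add: A.l_distr Lf field_simps flip: T_star t_def)
    qed
  qed (use lam in simp_all)
  with fin(1) have "t \<otimes>\<^bsub>A\<^esub> T = \<zero>\<^bsub>A\<^esub>" by simp
  then have "S \<otimes>\<^bsub>A\<^esub> star G S \<otimes>\<^bsub>A\<^esub> star G S = \<zero>\<^bsub>A\<^esub>" by (simp only: t_def T_star)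
  then have "S = \<zero>\<^bsub>A\<^esub>" by (rule square_star_eq_zero[rotated]) simp
  then show ?thesis by (simp add: S_def x)
qed

end

section \<open>From the defining equations to the parameters\<close>

lemma SEDF_D:
  assumes "is_SEDF G v m k lam D"
  shows "finite_comm_group G" and "v > 0" and "k > 0" and "lam > 0"
    and "k\<^sup>2 * (m - 1) = lam * (v - 1)" and "order G = v" and "disjoint_family_on D {1..m}"
    and "j \<in> {1..m} \<Longrightarrow> D j \<subseteq> carrier G" and "j \<in> {1..m} \<Longrightarrow> card (D j) = k"
    and "j \<in> {1..m} \<Longrightarrow> (\<Oplus>\<^bsub>group_algebra G\<^esub> l\<in>{1..m} - {j}.
        set_elem (D j) \<otimes>\<^bsub>group_algebra G\<^esub> set_elem (set_inv\<^bsub>G\<^esub> (D l))) =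
      complex_of_nat lam \<odot>\<^bsub>group_algebra G\<^esub> (set_elem (carrier G) \<ominus>\<^bsub>group_algebra G\<^esub> \<one>\<^bsub>group_algebra G\<^esub>)"
proof -
  note SEDF = assms[unfolded is_SEDF_def]
  have "comm_group G" using SEDF by (elim conjE)
  moreover have "finite (carrier G)" using SEDF by (elim conjE)
  ultimately show "finite_comm_group G" by (simp add: finite_comm_group_def finite_comm_group_axioms_def)
  show "v > 0" using SEDF by (elim conjE)
  show "k > 0" using SEDF by (elim conjE)
  show "lam > 0" using SEDF by (elim conjE)
  show "k\<^sup>2 * (m - 1) = lam * (v - 1)" using SEDF by (elim conjE)
  show "order G = v" using SEDF by (elim conjE)
  show "disjoint_family_on D {1..m}" using SEDF by (elim conjE)
  show "D j \<subseteq> carrier G" if "j \<in> {1..m}" using SEDF that by (elim conjE) blast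
  show "card (D j) = k" if "j \<in> {1..m}" using SEDF that by (elim conjE) blast
  show "(\<Oplus>\<^bsub>group_algebra G\<^esub> l\<in>{1..m} - {j}.
        set_elem (D j) \<otimes>\<^bsub>group_algebra G\<^esub> set_elem (set_inv\<^bsub>G\<^esub> (D l))) =
      complex_of_nat lam \<odot>\<^bsub>group_algebra G\<^esub> (set_elem (carrier G) \<ominus>\<^bsub>group_algebra G\<^esub> \<one>\<^bsub>group_algebra G\<^esub>)"
    if "j \<in> {1..m}"
    using SEDF that by (elim conjE) (erule bspec)
qed

text \<open>Centring subtracts 2 k^2 / v from every coefficient. By the parameter relation this
  equals \<lambda> (v - 1) / v, so \<lambda> (G - 1) becomes \<lambda> (G/v - 1). Stating it for
  indices \<open>j\<close>, \<open>l\<close>, \<open>m\<close> covers all three equations at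
  once.\<close>

lemma SEDF_product:
  fixes G (structure)
  assumes "is_SEDF G v 3 k lam D" and jlm: "{1..3} - {j} = {l, m}" "j \<in> {1..3}" "l \<noteq> m"
  shows "centred G (D j) \<otimes>\<^bsub>group_algebra G\<^esub>
      (star G (centred G (D l)) \<oplus>\<^bsub>group_algebra G\<^esub> star G (centred G (D m))) =
    \<ominus>\<^bsub>group_algebra G\<^esub> (complex_of_real (real lam) \<odot>\<^bsub>group_algebra G\<^esub> centred G {\<one>\<^bsub>G\<^esub>})"
proof -
  interpret finite_comm_group G by (rule SEDF_D(1)[OF assms(1)])
  have lm: "l \<in> {1..3}" "m \<in> {1..3}" using jlm(1) by blast+
  have v: "order G = v" "v > 0" "k\<^sup>2 * (3 - 1) = lam * (v - 1)"
    and D: "\<And>i. i \<in> {1..3} \<Longrightarrow> D i \<subseteq> carrier G \<and> card (D i) = k"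
    by (intro SEDF_D[OF assms(1)] conjI; assumption)+
  have "2 * (of_nat k)\<^sup>2 = (of_nat (k\<^sup>2 * (3 - 1)) :: complex)" by simp
  also have "\<dots> = of_nat lam * (of_nat v - 1)" unfolding v(3) using v(2) by (simp add: of_nat_diff)
  finally have kv: "2 * (of_nat k)\<^sup>2 = of_nat lam * (of_nat v - 1 :: complex)" .
  note sub = D[OF jlm(2)] D[OF lm(1)] D[OF lm(2)]
  have "(\<Oplus>\<^bsub>A\<^esub> l\<in>{1..3} - {j}. set_elem (D j) \<otimes>\<^bsub>A\<^esub> set_elem (set_inv (D l)))
      = complex_of_nat lam \<odot>\<^bsub>A\<^esub> (set_elem (carrier G) \<ominus>\<^bsub>A\<^esub> \<one>\<^bsub>A\<^esub>)"
    by (rule SEDF_D(10)[OF assms(1) jlm(2)])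
  then have eq: "set_elem (D j) \<otimes>\<^bsub>A\<^esub> set_elem (set_inv (D l)) \<oplus>\<^bsub>A\<^esub> set_elem (D j) \<otimes>\<^bsub>A\<^esub> set_elem (set_inv (D m))
      = complex_of_nat lam \<odot>\<^bsub>A\<^esub> (set_elem (carrier G) \<ominus>\<^bsub>A\<^esub> \<one>\<^bsub>A\<^esub>)"
    unfolding jlm(1) using jlm(3) sub by (simp add: set_elem_closed set_inv_subset)
  show ?thesis
  proof (rule group_algebra_eqI)
    fix x assume x: "x \<in> carrier G"
    have "(centred G (D j) \<otimes>\<^bsub>A\<^esub> (star G (centred G (D l)) \<oplus>\<^bsub>A\<^esub> star G (centred G (D m)))) x =
      (set_elem (D j) \<otimes>\<^bsub>A\<^esub> set_elem (set_inv (D l)) \<oplus>\<^bsub>A\<^esub> set_elem (D j) \<otimes>\<^bsub>A\<^esub> set_elem (set_inv (D m))) x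
        - 2 * (of_nat k)\<^sup>2 / of_nat v"
      using x sub by (simp add: A.r_distr star_centred mult_centred set_inv_subset card_set_inv v
          power2_eq_square)
    also have "\<dots> = of_nat lam * (1 - \<one>\<^bsub>A\<^esub> x) - of_nat lam * (of_nat v - 1) / of_nat v"
      unfolding eq kv using x by (simp add: a_minus_def set_elem_def)
    also have "\<dots> = - (of_nat lam * centred G {\<one>} x)"
      using x v by (simp add: centred_def set_elem_one field_simps)
    also have "\<dots> = (\<ominus>\<^bsub>A\<^esub> (complex_of_real (real lam) \<odot>\<^bsub>A\<^esub> centred G {\<one>})) x"
      by (simp add: carrier_group_algebra centred_def)
    finally show "(centred G (D j) \<otimes>\<^bsub>A\<^esub> (star G (centred G (D l)) \<oplus>\<^bsub>A\<^esub> star G (centred G (D m)))) x =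
      (\<ominus>\<^bsub>A\<^esub> (complex_of_real (real lam) \<odot>\<^bsub>A\<^esub> centred G {\<one>})) x" .
  qed (auto intro!: A.a_inv_closed simp: carrier_group_algebra[of "_ \<odot>\<^bsub>A\<^esub> _"] centred_def[of G "{\<one>}"])
qed

text \<open>At a point of \<open>D 1\<close> the sum of the centred sets has coefficient 1 - 3k/v by
  disjointness, and this coefficient vanishes.\<close>

lemma SEDF_three_order:
  fixes G (structure)
  assumes SEDF: "is_SEDF G v 3 k lam D"
  shows "v = 3 * k"
proof -
  interpret finite_comm_group G by (rule SEDF_D(1)[OF assms(1)])
  have v: "order G = v" "v > 0" "k > 0" "lam > 0"
    and D: "\<And>i. i \<in> {1..3} \<Longrightarrow> D i \<subseteq> carrier G \<and> card (D i) = k"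
    and disj: "disjoint_family_on D {1..3}"
    by (intro SEDF_D[OF SEDF] conjI; assumption)+
  have D123: "D 1 \<subseteq> carrier G \<and> card (D 1) = k" "D 2 \<subseteq> carrier G \<and> card (D 2) = k"
    "D 3 \<subseteq> carrier G \<and> card (D 3) = k"
    by (rule D; simp)+
  have zero: "centred G (D 1) \<oplus>\<^bsub>A\<^esub> centred G (D 2) \<oplus>\<^bsub>A\<^esub> centred G (D 3) = \<zero>\<^bsub>A\<^esub>"
  proof (rule centred_triple_sum_eq_zero[OF _ _ _ _ SEDF_product[OF SEDF] SEDF_product[OF SEDF]
        SEDF_product[OF SEDF]])
    show "D 1 \<subseteq> carrier G" "D 2 \<subseteq> carrier G" "D 3 \<subseteq> carrier G" "real lam > 0"
      using D123 v by simp_all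
  qed auto
  have "D 1 \<noteq> {}" using D123(1) v(3) by force
  then obtain x where x: "x \<in> D 1" by blast
  have "D 1 \<inter> D 2 = {}" "D 1 \<inter> D 3 = {}"
    by (rule disjoint_family_onD[OF disj]; simp)+
  then have "x \<notin> D 2" "x \<notin> D 3" "x \<in> carrier G" using x D123(1) by blast+
  then have "(3 * of_nat k / of_nat v :: complex) = 1"
    using fun_cong[OF zero, of x] x D123 v by (simp add: centred_def set_elem_def field_simps)
  then have "(of_nat (3 * k) :: complex) = of_nat v" using v(2) by (simp add: field_simps)
  then show ?thesis by (simp only: of_nat_eq_iff)
qed

theorem theorem3p3:
  fixes v k lam :: nat
  assumes "v > 3"
  shows "\<not> (\<exists>(G :: 'a monoid) (D :: nat \<Rightarrow> 'a set). is_SEDF G v 3 k lam D)"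
proof
  assume "\<exists>(G :: 'a monoid) (D :: nat \<Rightarrow> 'a set). is_SEDF G v 3 k lam D"
  then obtain G :: "'a monoid" and D where SEDF: "is_SEDF G v 3 k lam D" by blast
  have v: "v = 3 * k" by (rule SEDF_three_order[OF SEDF])
  have k: "k > 0" "lam > 0" "k\<^sup>2 * (3 - 1) = lam * (3 * k - 1)"
    using SEDF_D(3-5)[OF SEDF] v by simp_all
  \<comment> \<open>A common divisor divides both \<open>3 * k\<close> and its predecessor, hence
    1.\<close>
  have "coprime k (3 * k - 1)"
  proof (rule coprimeI)
    fix d assume "d dvd k" "d dvd 3 * k - 1"
    then have "d dvd 3 * k - (3 * k - 1)" by (simp only: dvd_diff_nat dvd_mult)
    moreover have "3 * k - (3 * k - 1) = 1" using k(1) by arith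
    ultimately show "is_unit d" by metis
  qed
  then have "coprime (k\<^sup>2) (3 * k - 1)" by simp
  moreover have "k\<^sup>2 dvd lam * (3 * k - 1)" unfolding k(3)[symmetric] by simp
  \<comment> \<open>By coprimality \<open>k\<^sup>2\<close> divides the positive number
    \<open>lam\<close>. Multiplying the bound by \<open>3 * k - 1\<close> and using the parameter
    relation gives 3k - 1 \<le> 2, so k = 1 and v = 3.\<close>
  ultimately have "k\<^sup>2 \<le> lam" using k(2) by (simp add: coprime_dvd_mult_left_iff dvd_imp_le)
  then have "k\<^sup>2 * (3 * k - 1) \<le> k\<^sup>2 * (3 - 1)" unfolding k(3) by (rule mult_le_mono1)
  then have "k \<le> 1" using k(1) by simp
  with assms v show False by simp
qed

end
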